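(* Let $G=(V,E)$ be a finite graph, with multiple edges and loops allowed. For every non-loop edge $e=u_1u_2\in E$, $$A_{G}(V)=A_{G\setminus e}(V)+A_{G/e}(V/e)$$ as polynomials in $\mathbb{Z}[V]$, where in $A_{G/e}(V/e)$ the variable $v_e$ attached to the vertex of $G/e$ created by contracting $e$ is replaced by the element $v_e=1-(1-u_1)(1-u_2)=u_1+u_2-u_1u_2\in\mathbb{Z}[V]$.
   Context: Graphs are finite and may have multiple edges and loops. An orientation of $G$ assigns a direction to each edge; it is acyclic if it has no directed cycles (so a graph with a loop has no acyclic orientation). $\mathcal{A}(G)$ is the set of acyclic orientations of $G$. For $\mathfrak{o}\in\mathcal{A}(G)$, a vertex $v$ is a sink if every edge incident with $v$ is directed toward $v$ (in particular, isolated vertices are sinks); $\operatorname{Sink}(\mathfrak{o})$ is the set of sinks of $\mathfrak{o}$. To each vertex $v\in V$ associate a commuting variable, also denoted $v$, and let $\mathbb{Z}[V]$ be the polynomial ring in these variables. The acyclic orientation polynomial of $G$ is $$A_G(V)=\sum_{\mathfrak{o}\in\mathcal{A}(G)}\ \prod_{v\in\operatorname{Sink}(\mathfrak{o})}v\ \in\mathbb{Z}[V]$$ (so $A_G(V)=0$ if $G$ has a loop). $G\setminus e$ is the graph obtained from $G$ by deleting the edge $e$ (same vertex set $V$). For a non-loop edge $e=u_1u_2$, $G/e$ is the graph obtained by contracting $e$: its vertex set is $V/e=(V\setminus\{u_1,u_2\})\cup\{v_e\}$, where $v_e$ is the new vertex, and its edges are the edges of $G$ other than $e$, with endpoints $u_1,u_2$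 replaced by $v_e$; any edge of $G$ parallel to $e$ becomes a loop in $G/e$, and multiple edges are kept. *)

theory Defs
  imports Main "HOL-Library.FuncSet" "HOL-Library.Uprod" "HOL-Library.Poly_Mapping"
begin

record ('v, 'e) multigraph =
  verts :: "'v set"
  edges :: "'e set"
  ends :: "'e \<Rightarrow> 'v uprod"

(* Edges are abstract objects, so parallel edges are distinct edges with equal ends;
   e is a loop at v iff ends G e = Upair v v. *)
definition finite_multigraph :: "('v, 'e) multigraph \<Rightarrow> bool" where
  "finite_multigraph G \<longleftrightarrow>
     finite (verts G) \<and> finite (edges G) \<and> (\<forall>e\<in>edges G. set_uprod (ends G e) \<subseteq> verts G)"

(* An orientation sends each edge to an ordered pair (tail, head) of its ends. The
   functions are extensional, so that orientations differing only off the edge set are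
   not counted separately. A loop has just the one value (v, v) here instead of two
   directions; this is immaterial below, as either one is a directed cycle. *)
definition orientations :: "('v, 'e) multigraph \<Rightarrow> ('e \<Rightarrow> 'v \<times> 'v) set" where
  "orientations G = (\<Pi>\<^sub>E e\<in>edges G. {(x, y). Upair x y = ends G e})"

definition acyclic_orientations :: "('v, 'e) multigraph \<Rightarrow> ('e \<Rightarrow> 'v \<times> 'v) set" where
  "acyclic_orientations G = {\<omega> \<in> orientations G. acyclic (\<omega> ` edges G)}"

definition sinks :: "('v, 'e) multigraph \<Rightarrow> ('e \<Rightarrow> 'v \<times> 'v) \<Rightarrow> 'v set" where
  "sinks G \<omega> = {v \<in> verts G. \<forall>e\<in>edges G. v \<in> set_uprod (ends G e) \<longrightarrow> snd (\<omega> e) = v}"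

(* Integer polynomials in commuting variables indexed by 'v: finitely supported
   functions from monomials (finitely supported exponent vectors) to coefficients,
   with the convolution product of Poly_Mapping. *)
type_synonym 'v int_mpoly = "('v \<Rightarrow>\<^sub>0 nat) \<Rightarrow>\<^sub>0 int"

definition Var :: "'v \<Rightarrow> 'v int_mpoly" where
  "Var v = Poly_Mapping.single (Poly_Mapping.single v 1) 1"

definition subst_poly :: "('w \<Rightarrow> 'v int_mpoly) \<Rightarrow> 'w int_mpoly \<Rightarrow> 'v int_mpoly" where
  "subst_poly \<sigma> p =
     (\<Sum>m\<in>Poly_Mapping.keys p. of_int (Poly_Mapping.lookup p m) *
        (\<Prod>w\<in>Poly_Mapping.keys m. \<sigma> w ^ Poly_Mapping.lookup m w))"

definition acyclic_orientation_poly :: "('v, 'e) multigraph \<Rightarrow> 'v int_mpoly" where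
  "acyclic_orientation_poly G =
     (\<Sum>\<omega>\<in>acyclic_orientations G. \<Prod>v\<in>sinks G \<omega>. Var v)"

definition delete_edge :: "('v, 'e) multigraph \<Rightarrow> 'e \<Rightarrow> ('v, 'e) multigraph" where
  "delete_edge G e = G\<lparr>edges := edges G - {e}\<rparr>"

(* The option type supplies a fresh vertex: None is the vertex created by the
   contraction, and Some v is the old vertex v. *)
definition contract_edge :: "('v, 'e) multigraph \<Rightarrow> 'e \<Rightarrow> ('v option, 'e) multigraph" where
  "contract_edge G e =
     \<lparr>verts = insert None (Some ` (verts G - set_uprod (ends G e))),
      edges = edges G - {e},
      ends = (\<lambda>f. map_uprod (\<lambda>x. if x \<in> set_uprod (ends G e) then None else Some x) (ends G f))\<rparr>"

end

theory Submission
  imports Defs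
begin

text \<open>
  Fix an acyclic orientation of \<open>G \<setminus> e\<close> and compare its contributions to the three
  polynomials. It extends to acyclic orientations of \<open>G\<close> in one or two ways, and in two ways
  precisely when there is no directed path between \<open>u1\<close> and \<open>u2\<close>, i.e. when it descends to an
  acyclic orientation of \<open>G / e\<close>. Directing \<open>e\<close> away from \<open>u1\<close> removes exactly \<open>u1\<close> from the
  sinks, and the new vertex of \<open>G / e\<close> is a sink iff both \<open>u1\<close> and \<open>u2\<close> are. If there is a path
  from \<open>u1\<close> to \<open>u2\<close>, then \<open>u1\<close> is not a sink and the only extension keeps the sinks; otherwise
  the identity is checked for each of the four possibilities for \<open>u1\<close> and \<open>u2\<close> being sinks.
\<close>

section \<open>Substitution into polynomials\<close>

text \<open>Coefficients outside the keys vanish. Additivity needs a common index set, since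
  cancellation can shrink the keys of a sum.\<close>

lemma subst_poly_eq_sum_superset:
  assumes "finite S" "Poly_Mapping.keys p \<subseteq> S"
  shows "subst_poly \<sigma> p = (\<Sum>m\<in>S. of_int (Poly_Mapping.lookup p m) *
           (\<Prod>w\<in>Poly_Mapping.keys m. \<sigma> w ^ Poly_Mapping.lookup m w))"
  unfolding subst_poly_def
  by (rule sum.mono_neutral_left) (use assms in \<open>auto simp: in_keys_iff\<close>)

lemma subst_poly_zero: "subst_poly \<sigma> 0 = 0"
  by (simp add: subst_poly_def)

lemma subst_poly_add: "subst_poly \<sigma> (p + q) = subst_poly \<sigma> p + subst_poly \<sigma> q"
proof -
  let ?S = "Poly_Mapping.keys p \<union> Poly_Mapping.keys q"
  have "Poly_Mapping.keys (p + q) \<subseteq> ?S"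
    by (rule Poly_Mapping.keys_add)
  then show ?thesis
    by (simp add: subst_poly_eq_sum_superset[of ?S] lookup_add distrib_right sum.distrib)
qed

lemma subst_poly_sum: "subst_poly \<sigma> (\<Sum>x\<in>A. f x) = (\<Sum>x\<in>A. subst_poly \<sigma> (f x))"
  by (induction A rule: infinite_finite_induct) (simp_all add: subst_poly_zero subst_poly_add)

lemma prod_Var_eq_single:
  "(\<Prod>v\<in>S. Var v) = Poly_Mapping.single (\<Sum>v\<in>S. Poly_Mapping.single v 1) 1"
  by (induction S rule: infinite_finite_induct) (simp_all add: Var_def mult_single)

text \<open>The monomial is square-free: its exponents are 1 on \<open>S\<close> and 0 elsewhere.
  With additivity this settles every substitution into an acyclic orientation polynomial.\<close>

lemma subst_poly_prod_Var:
  assumes "finite S"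
  shows "subst_poly \<sigma> (\<Prod>v\<in>S. Var v) = (\<Prod>v\<in>S. \<sigma> v)"
proof -
  let ?m = "\<Sum>v\<in>S. Poly_Mapping.single v (1::nat)"
  have lookup: "Poly_Mapping.lookup ?m w = (if w \<in> S then 1 else 0)" for w
    using assms by (simp add: lookup_sum lookup_single when_def sum.delta)
  then have keys: "Poly_Mapping.keys ?m = S"
    by (auto simp: in_keys_iff split: if_splits)
  show ?thesis
    unfolding prod_Var_eq_single subst_poly_def by (simp add: keys lookup del: One_nat_def)
qed

section \<open>Acyclicity under identification of points\<close>

lemma trancl_map_prod_image:
  assumes "(x, y) \<in> r\<^sup>+"
  shows "(q x, q y) \<in> (map_prod q q ` r)\<^sup>+"
  using assms
proof (induction rule: trancl_induct)
  case (base y)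
  then show ?case by (intro r_into_trancl image_eqI[of _ _ "(x, y)"]) auto
next
  case (step y z)
  then have "(q y, q z) \<in> map_prod q q ` r" by (intro image_eqI[of _ _ "(y, z)"]) auto
  with step.IH show ?case by (rule trancl_into_trancl)
qed

text \<open>A cycle in the quotient, cut at its visits to the image of \<open>U\<close>, breaks into
  paths of \<open>r\<close> from \<open>U\<close> to \<open>U\<close>; a cycle that avoids this
  point is already a cycle of \<open>r\<close>.\<close>

lemma acyclic_map_prod_image_iff:
  assumes q: "\<And>x y. q x = q y \<longleftrightarrow> x = y \<or> (x \<in> U \<and> y \<in> U)"
  shows "acyclic (map_prod q q ` r) \<longleftrightarrow> acyclic r \<and> (\<forall>i\<in>U. \<forall>j\<in>U. (i, j) \<notin> r\<^sup>+)"
proof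
  assume ac: "acyclic (map_prod q q ` r)"
  \<comment> \<open>Covers \<open>x = y\<close> and two points of \<open>U\<close> at once: a path
    between points with the same image closes up in the quotient.\<close>
  have "(x, y) \<notin> r\<^sup>+" if "q x = q y" for x y
    using trancl_map_prod_image[of x y r q] ac that unfolding acyclic_def by auto
  then show "acyclic r \<and> (\<forall>i\<in>U. \<forall>j\<in>U. (i, j) \<notin> r\<^sup>+)"
    unfolding acyclic_def using q by blast
next
  assume "acyclic r \<and> (\<forall>i\<in>U. \<forall>j\<in>U. (i, j) \<notin> r\<^sup>+)"
  then have ac: "\<And>x. (x, x) \<notin> r\<^sup>+" and U: "\<And>i j. i \<in> U \<Longrightarrow> j \<in> U \<Longrightarrow> (i, j) \<notin> r\<^sup>+"
    unfolding acyclic_def by auto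
  \<comment> \<open>A path in the quotient lifts to a path that jumps inside \<open>U\<close> at most once: between two
      jumps there would be a path from \<open>U\<close> to \<open>U\<close>.\<close>
  have lift: "\<exists>x y. q x = a \<and> q y = b \<and>
      ((x, y) \<in> r\<^sup>+ \<or> (\<exists>i\<in>U. \<exists>j\<in>U. (x, i) \<in> r\<^sup>+ \<and> (j, y) \<in> r\<^sup>+))"
    if "(a, b) \<in> (map_prod q q ` r)\<^sup>+" for a b
    using that
  proof (induction rule: trancl_induct)
    case (base b)
    then show ?case by auto
  next
    case (step b c)
    then obtain y' z where yz: "(y', z) \<in> r" "b = q y'" "c = q z" by auto
    from step.IH obtain x y where xy: "q x = a" "q y = b"
      and path: "(x, y) \<in> r\<^sup>+ \<or> (\<exists>i\<in>U. \<exists>j\<in>U. (x, i) \<in> r\<^sup>+ \<and> (j, y) \<in> r\<^sup>+)" by auto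
    consider "y = y'" | "y \<in> U" "y' \<in> U" using q xy yz by metis
    then show ?case
    proof cases
      case 1
      then have "(x, z) \<in> r\<^sup>+ \<or> (\<exists>i\<in>U. \<exists>j\<in>U. (x, i) \<in> r\<^sup>+ \<and> (j, z) \<in> r\<^sup>+)"
        using yz(1) path by (meson trancl_into_trancl)
      then show ?thesis using xy(1) yz(3) by blast
    next
      case 2
      then have "(x, y) \<in> r\<^sup>+" using path U by blast
      then show ?thesis using 2 xy yz by blast
    qed
  qed
  show "acyclic (map_prod q q ` r)"
    unfolding acyclic_def
  proof (intro allI notI)
    fix a assume "(a, a) \<in> (map_prod q q ` r)\<^sup>+"
    from lift[OF this] obtain x y where xy: "q x = a" "q y = a"
      and path: "(x, y) \<in> r\<^sup>+ \<or> (\<exists>i\<in>U. \<exists>j\<in>U. (x, i) \<in> r\<^sup>+ \<and> (j, y) \<in> r\<^sup>+)" by blast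
    consider "x = y" | "x \<in> U" "y \<in> U" using q xy by metis
    then show False
    proof cases
      case 1
      \<comment> \<open>If the path jumps, then \<open>j\<close> reaches \<open>x = y\<close> and
        from there \<open>i\<close>, which is a path from \<open>U\<close> to
        \<open>U\<close>.\<close>
      then show ?thesis using path ac U by (meson trancl_trans)
    next
      case 2
      then show ?thesis using path U by blast
    qed
  qed
qed

section \<open>Orientations of the deletion and the contraction\<close>

locale multigraph_with_nonloop =
  fixes G :: "('v, 'e) multigraph" and e :: 'e and u1 u2 :: 'v
  assumes fin: "finite_multigraph G"
    and e_in: "e \<in> edges G"
    and ends_e: "ends G e = Upair u1 u2"
    and neq: "u1 \<noteq> u2"
begin

abbreviation "E' \<equiv> edges G - {e}"
abbreviation "H \<equiv> delete_edge G e"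
abbreviation "K \<equiv> contract_edge G e"

definition quot :: "'v \<Rightarrow> 'v option" where
  "quot x = (if x \<in> {u1, u2} then None else Some x)"

text \<open>Restricted to \<open>E'\<close> because orientations are extensional.\<close>

definition contract_orientation :: "('e \<Rightarrow> 'v \<times> 'v) \<Rightarrow> 'e \<Rightarrow> 'v option \<times> 'v option" where
  "contract_orientation \<omega> = (\<lambda>f\<in>E'. map_prod quot quot (\<omega> f))"

lemma quot_eq_iff: "quot x = quot y \<longleftrightarrow> x = y \<or> (x \<in> {u1, u2} \<and> y \<in> {u1, u2})"
  by (auto simp: quot_def)

lemma delete_simps: "verts H = verts G" "edges H = E'" "ends H = ends G"
  by (simp_all add: delete_edge_def)

lemma contract_simps:
  "verts K = insert None (Some ` (verts G - {u1, u2}))"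
  "edges K = E'"
  "ends K f = map_uprod quot (ends G f)"
  by (simp_all add: contract_edge_def ends_e quot_def[abs_def])

lemma finite_verts: "finite (verts G)" and finite_edges: "finite (edges G)"
  and endpoints_in_verts: "u1 \<in> verts G" "u2 \<in> verts G"
  using fin e_in ends_e unfolding finite_multigraph_def by fastforce+

lemma finite_sinks: "finite (sinks H \<omega>)"
  using finite_verts by (simp add: sinks_def delete_simps)

lemma orientations_delete: "orientations H = (\<Pi>\<^sub>E f\<in>E'. {(x, y). Upair x y = ends G f})"
  by (simp add: orientations_def delete_simps)

lemma ends_eq: "\<omega> \<in> orientations H \<Longrightarrow> f \<in> E' \<Longrightarrow> ends G f = Upair (fst (\<omega> f)) (snd (\<omega> f))"
  unfolding orientations_delete by (drule (1) PiE_mem) auto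

lemma directions_e: "{(x, y). Upair x y = ends G e} = {(u1, u2), (u2, u1)}"
  by (auto simp: ends_e)

lemma finite_orientations: "finite (orientations H)"
  unfolding orientations_delete
proof (rule finite_PiE)
  fix f
  obtain x y where "ends G f = Upair x y" by (cases "ends G f")
  then have "{(x, y). Upair x y = ends G f} \<subseteq> {(x, y), (y, x)}" by auto
  then show "finite {(x, y). Upair x y = ends G f}" by (rule finite_subset) simp
qed (use finite_edges in simp)

section \<open>Splitting by the direction of \<open>e\<close>\<close>

lemma image_fun_upd: "(\<omega>(e := p)) ` edges G = insert p (\<omega> ` E')"
  using e_in by (auto simp: image_iff)

text \<open>Acyclicity survives the removal of \<open>e\<close>, so an acyclic orientation of
  \<open>G\<close> is one of \<open>H\<close> together with a direction of \<open>e\<close> that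
  closes no cycle.\<close>

lemma acyclic_orientation_poly_split:
  "acyclic_orientation_poly G =
     (\<Sum>\<omega>\<in>acyclic_orientations H. \<Sum>p\<in>{(u1, u2), (u2, u1)}.
        if acyclic (insert p (\<omega> ` E')) then \<Prod>v\<in>sinks G (\<omega>(e := p)). Var v else 0)"
proof -
  let ?D = "{(u1, u2), (u2, u1)}"
  let ?g = "\<lambda>(p, \<omega>). \<omega>(e := p)"
  let ?w = "\<lambda>p \<omega>. if acyclic (insert p (\<omega> ` E')) then \<Prod>v\<in>sinks G (\<omega>(e := p)). Var v else 0"
  have "edges G = insert e E'" using e_in by auto
  then have "orientations G = (\<Pi>\<^sub>E f\<in>insert e E'. {(x, y). Upair x y = ends G f})"
    unfolding orientations_def by simp
  then have O_eq: "orientations G = ?g ` (?D \<times> orientations H)"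
    by (simp only: PiE_insert_eq directions_e orientations_delete)
  have inj: "inj_on ?g (?D \<times> orientations H)"
    using inj_combinator[of e E' "\<lambda>f. {(x, y). Upair x y = ends G f}"]
    unfolding directions_e orientations_delete by simp
  have finO: "finite (orientations G)"
    unfolding O_eq using finite_orientations by simp
  \<comment> \<open>The condition moves into the summand because all orientations, unlike the
    acyclic ones, form a product over the edges.\<close>
  have "acyclic_orientation_poly G =
      (\<Sum>\<omega>\<in>orientations G. if acyclic (\<omega> ` edges G) then \<Prod>v\<in>sinks G \<omega>. Var v else 0)"
    unfolding acyclic_orientation_poly_def acyclic_orientations_def
    using finO by (simp add: sum.inter_filter)
  also have "\<dots> = (\<Sum>(p, \<omega>)\<in>?D \<times> orientations H. ?w p \<omega>)"
    unfolding O_eq by (subst sum.reindex[OF inj]) (simp only: case_prod_unfold image_fun_upd o_def)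
  also have "\<dots> = (\<Sum>p\<in>?D. \<Sum>\<omega>\<in>orientations H. ?w p \<omega>)"
    by (rule sum.cartesian_product[symmetric])
  \<comment> \<open>A cycle among the edges of \<open>H\<close> remains after \<open>p\<close> is
    inserted, so the omitted terms are 0.\<close>
  also have "\<dots> = (\<Sum>p\<in>?D. \<Sum>\<omega>\<in>acyclic_orientations H. ?w p \<omega>)"
    by (intro sum.cong refl sum.mono_neutral_right)
       (use finite_orientations in
         \<open>auto simp: acyclic_orientations_def delete_simps acyclic_insert\<close>)
  also have "\<dots> = (\<Sum>\<omega>\<in>acyclic_orientations H. \<Sum>p\<in>?D. ?w p \<omega>)"
    by (rule sum.swap)
  finally show ?thesis .
qed

text \<open>An edge parallel to \<open>e\<close> has a single orientation in the contraction but two in the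
  deletion; the second condition excludes such edges.\<close>

definition liftable :: "('e \<Rightarrow> 'v \<times> 'v) \<Rightarrow> bool" where
  "liftable \<omega> \<longleftrightarrow> acyclic (\<omega> ` E') \<and> (\<forall>i\<in>{u1, u2}. \<forall>j\<in>{u1, u2}. (i, j) \<notin> (\<omega> ` E')\<^sup>+)"

section \<open>Bijection between liftable orientations and acyclic orientations of
  \<open>K\<close>\<close>

lemma acyclic_contract_iff: "acyclic (contract_orientation \<omega> ` E') \<longleftrightarrow> liftable \<omega>"
proof -
  have "contract_orientation \<omega> ` E' = map_prod quot quot ` \<omega> ` E'"
    by (simp add: contract_orientation_def image_image)
  then show ?thesis
    unfolding liftable_def by (simp add: acyclic_map_prod_image_iff[OF quot_eq_iff])
qed

text \<open>An edge that the contraction would turn into a loop at the new vertex is itself a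
  forbidden path of length one.\<close>

lemma liftable_edge:
  assumes "liftable \<omega>" "f \<in> E'" "fst (\<omega> f) \<in> {u1, u2}" "snd (\<omega> f) \<in> {u1, u2}"
  shows False
proof -
  have "(fst (\<omega> f), snd (\<omega> f)) \<in> (\<omega> ` E')\<^sup>+"
    using assms(2) by (intro r_into_trancl) auto
  with assms show False unfolding liftable_def by blast
qed

text \<open>Two orientations can differ at an edge only by a reversal, and \<open>quot\<close> hides
  a reversal only if both ends are collapsed.\<close>

lemma inj_on_contract_orientation:
  "inj_on contract_orientation {\<omega> \<in> acyclic_orientations H. liftable \<omega>}"
proof (rule inj_onI)
  fix \<omega> \<eta>
  assume \<omega>: "\<omega> \<in> {\<omega> \<in> acyclic_orientations H. liftable \<omega>}"
    and \<eta>: "\<eta> \<in> {\<omega> \<in> acyclic_orientations H. liftable \<omega>}"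
    and eq: "contract_orientation \<omega> = contract_orientation \<eta>"
  have O: "\<omega> \<in> orientations H" "\<eta> \<in> orientations H"
    using \<omega> \<eta> by (auto simp: acyclic_orientations_def)
  show "\<omega> = \<eta>"
  proof (rule PiE_ext[OF O[unfolded orientations_delete]])
    fix f assume f: "f \<in> E'"
    obtain x y where xy: "\<omega> f = (x, y)" by (cases "\<omega> f")
    obtain x' y' where xy': "\<eta> f = (x', y')" by (cases "\<eta> f")
    have "ends G f = Upair x y" using ends_eq[OF O(1) f] xy by simp
    moreover have "ends G f = Upair x' y'" using ends_eq[OF O(2) f] xy' by simp
    ultimately have "Upair x y = Upair x' y'" by (rule subst)
    moreover have "quot x = quot x'"
      using fun_cong[OF eq, of f] f xy xy' by (simp add: contract_orientation_def)
    moreover have "x \<notin> {u1, u2} \<or> y \<notin> {u1, u2}"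
      using liftable_edge[of \<omega> f] \<omega> f xy by auto
    ultimately show "\<omega> f = \<eta> f"
      unfolding xy xy' quot_eq_iff by auto
  qed
qed

text \<open>For surjectivity, a preimage is chosen edge by edge; its acyclicity and liftability then
  follow from \<open>acyclic_contract_iff\<close>.\<close>

lemma contract_orientation_image:
  "contract_orientation ` {\<omega> \<in> acyclic_orientations H. liftable \<omega>} = acyclic_orientations K"
proof (intro equalityI subsetI)
  fix \<psi> assume "\<psi> \<in> contract_orientation ` {\<omega> \<in> acyclic_orientations H. liftable \<omega>}"
  then obtain \<omega> where \<omega>: "\<omega> \<in> orientations H" "liftable \<omega>" "\<psi> = contract_orientation \<omega>"
    by (auto simp: acyclic_orientations_def)
  have "contract_orientation \<omega> \<in> orientations K"
    unfolding orientations_def contract_simps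
    using ends_eq[OF \<omega>(1)] by (auto simp: contract_orientation_def case_prod_beta)
  then show "\<psi> \<in> acyclic_orientations K"
    using \<omega> by (simp add: acyclic_orientations_def contract_simps acyclic_contract_iff)
next
  fix \<psi> assume \<psi>: "\<psi> \<in> acyclic_orientations K"
  then have \<psi>O: "\<psi> \<in> orientations K" by (simp add: acyclic_orientations_def)
  have "\<exists>p. Upair (fst p) (snd p) = ends G f \<and> map_prod quot quot p = \<psi> f" if f: "f \<in> E'" for f
  proof -
    obtain x y where xy: "ends G f = Upair x y" by (cases "ends G f")
    have "\<psi> f \<in> {(a, b). Upair a b = map_uprod quot (ends G f)}"
      using \<psi>O f unfolding orientations_def contract_simps by (rule PiE_mem)
    then have "\<psi> f = map_prod quot quot (x, y) \<or> \<psi> f = map_prod quot quot (y, x)"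
      using xy by auto
    then show ?thesis
      using xy by (metis Upair_inject fst_conv snd_conv)
  qed
  then obtain p where p: "\<And>f. f \<in> E' \<Longrightarrow>
      Upair (fst (p f)) (snd (p f)) = ends G f \<and> map_prod quot quot (p f) = \<psi> f"
    by metis
  let ?\<omega> = "restrict p E'"
  have eq: "contract_orientation ?\<omega> = \<psi>"
  proof
    fix f
    show "contract_orientation ?\<omega> f = \<psi> f"
      using p[of f] \<psi>O
      by (cases "f \<in> E'")
         (auto simp: contract_orientation_def orientations_def contract_simps PiE_def
           extensional_def)
  qed
  have "?\<omega> \<in> orientations H"
    unfolding orientations_delete using p by (auto simp: case_prod_beta)
  moreover have lift: "liftable ?\<omega>"
    using \<psi> eq unfolding acyclic_contract_iff[symmetric]
    by (simp add: acyclic_orientations_def contract_simps)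
  ultimately have "?\<omega> \<in> {\<omega> \<in> acyclic_orientations H. liftable \<omega>}"
    by (simp add: acyclic_orientations_def delete_simps liftable_def)
  with eq show "\<psi> \<in> contract_orientation ` {\<omega> \<in> acyclic_orientations H. liftable \<omega>}"
    by blast
qed

lemma finite_acyclic_orientations: "finite (acyclic_orientations H)"
  using finite_orientations by (simp add: acyclic_orientations_def)

section \<open>Sinks of the extensions and of the contraction\<close>

text \<open>The edge \<open>e\<close> adds a condition only at its ends: the tail \<open>x\<close>
  violates it, the head \<open>y\<close> satisfies it.\<close>

lemma sinks_extend:
  assumes "{x, y} = {u1, u2}"
  shows "sinks G (\<omega>(e := (x, y))) = sinks H \<omega> - {x}"
proof -
  have "edges G = insert e E'" using e_in by auto
  moreover have "x \<noteq> y" "set_uprod (ends G e) = {x, y}" using assms neq ends_e by auto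
  ultimately show ?thesis
    unfolding sinks_def delete_simps by auto
qed

text \<open>Away from the collapsed pair \<open>quot\<close> is injective and the sink conditions
  agree. At \<open>None\<close>, liftability leaves no edge inside the pair, so both conditions say
  that no edge starts at \<open>u1\<close> or \<open>u2\<close>.\<close>

lemma sinks_contract:
  assumes "\<omega> \<in> orientations H" "liftable \<omega>"
  shows "sinks K (contract_orientation \<omega>) =
    Some ` (sinks H \<omega> - {u1, u2}) \<union> (if u1 \<in> sinks H \<omega> \<and> u2 \<in> sinks H \<omega> then {None} else {})"
proof -
  have set_ends: "set_uprod (ends G f) = {fst (\<omega> f), snd (\<omega> f)}" if "f \<in> E'" for f
    using ends_eq[OF assms(1) that] by simp
  have set_ends_K: "set_uprod (ends K f) = {quot (fst (\<omega> f)), quot (snd (\<omega> f))}" if "f \<in> E'" for f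
    using ends_eq[OF assms(1) that] by (simp add: contract_simps)
  have snd_contract: "snd (contract_orientation \<omega> f) = quot (snd (\<omega> f))" if "f \<in> E'" for f
    using that by (simp add: contract_orientation_def)
  \<comment> \<open>Heads satisfy the sink condition trivially, so it is tested only on edges with
    tail \<open>v\<close>.\<close>
  have H: "v \<in> sinks H \<omega> \<longleftrightarrow> v \<in> verts G \<and> (\<forall>f\<in>E'. fst (\<omega> f) \<noteq> v \<or> snd (\<omega> f) = v)" for v
    unfolding sinks_def delete_simps using set_ends by auto
  have K: "a \<in> sinks K (contract_orientation \<omega>) \<longleftrightarrow>
      a \<in> verts K \<and> (\<forall>f\<in>E'. quot (fst (\<omega> f)) \<noteq> a \<or> quot (snd (\<omega> f)) = a)" for a
    unfolding sinks_def contract_simps(2) using set_ends_K snd_contract by auto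
  have quot_None: "quot x = None \<longleftrightarrow> x \<in> {u1, u2}"
    and quot_Some: "quot x = Some v \<longleftrightarrow> x = v \<and> v \<notin> {u1, u2}" for x v
    by (auto simp: quot_def)
  have "None \<in> sinks K (contract_orientation \<omega>) \<longleftrightarrow> u1 \<in> sinks H \<omega> \<and> u2 \<in> sinks H \<omega>"
    unfolding H K quot_None contract_simps
    using liftable_edge[OF assms(2)] endpoints_in_verts by blast
  moreover have "Some v \<in> sinks K (contract_orientation \<omega>) \<longleftrightarrow> v \<in> sinks H \<omega> - {u1, u2}" for v
    unfolding H K quot_Some contract_simps Diff_iff by auto
  ultimately have "a \<in> sinks K (contract_orientation \<omega>) \<longleftrightarrow>
      a \<in> Some ` (sinks H \<omega> - {u1, u2}) \<union>
        (if u1 \<in> sinks H \<omega> \<and> u2 \<in> sinks H \<omega> then {None} else {})" for a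
    by (cases a) auto
  then show ?thesis by blast
qed

text \<open>The first edge of the path leaves \<open>x\<close>; at a sink it would have to be a
  loop.\<close>

lemma not_sink_if_path:
  assumes "\<omega> \<in> acyclic_orientations H" "(x, y) \<in> (\<omega> ` E')\<^sup>+"
  shows "x \<notin> sinks H \<omega>"
proof
  assume sink: "x \<in> sinks H \<omega>"
  from assms(2) obtain z where "(x, z) \<in> \<omega> ` E'" by (meson tranclD)
  then obtain f where f: "f \<in> E'" "\<omega> f = (x, z)" by (elim imageE) (rule that, simp_all)
  have "ends G f = Upair x z"
    using ends_eq[of \<omega> f] assms(1) f by (simp add: acyclic_orientations_def)
  moreover have "\<forall>g\<in>E'. x \<in> set_uprod (ends G g) \<longrightarrow> snd (\<omega> g) = x"
    using sink by (simp add: sinks_def delete_simps)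
  then have "x \<in> set_uprod (ends G f) \<longrightarrow> snd (\<omega> f) = x" using f(1) by (rule bspec)
  ultimately have "z = x" using f(2) by simp
  with f have "(x, x) \<in> (\<omega> ` E')\<^sup>+" by (metis image_eqI r_into_trancl)
  then show False
    using assms(1) by (simp add: acyclic_orientations_def acyclic_def delete_simps)
qed

section \<open>Comparison of the contributions\<close>

definition contract_subst :: "'v option \<Rightarrow> 'v int_mpoly" where
  "contract_subst w = (case w of None \<Rightarrow> 1 - (1 - Var u1) * (1 - Var u2) | Some v \<Rightarrow> Var v)"

lemma subst_acyclic_orientation_poly_contract:
  "subst_poly contract_subst (acyclic_orientation_poly K) =
     (\<Sum>\<omega>\<in>acyclic_orientations H.
        if liftable \<omega>
        then (\<Prod>v\<in>sinks H \<omega> - {u1, u2}. Var v) *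
          (if u1 \<in> sinks H \<omega> \<and> u2 \<in> sinks H \<omega> then 1 - (1 - Var u1) * (1 - Var u2) else 1)
        else 0)"
proof -
  let ?B = "{\<omega> \<in> acyclic_orientations H. liftable \<omega>}"
  let ?c = "\<lambda>\<omega>. (\<Prod>v\<in>sinks H \<omega> - {u1, u2}. Var v) *
    (if u1 \<in> sinks H \<omega> \<and> u2 \<in> sinks H \<omega> then 1 - (1 - Var u1) * (1 - Var u2) else 1)"
  have "acyclic_orientation_poly K =
      (\<Sum>\<omega>\<in>?B. \<Prod>v\<in>sinks K (contract_orientation \<omega>). Var v)"
    unfolding acyclic_orientation_poly_def contract_orientation_image[symmetric]
    by (simp add: sum.reindex[OF inj_on_contract_orientation] o_def)
  then have "subst_poly contract_subst (acyclic_orientation_poly K) =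
      (\<Sum>\<omega>\<in>?B. subst_poly contract_subst (\<Prod>v\<in>sinks K (contract_orientation \<omega>). Var v))"
    by (simp add: subst_poly_sum)
  also have "\<dots> = (\<Sum>\<omega>\<in>?B. ?c \<omega>)"
  proof (rule sum.cong[OF refl])
    fix \<omega> assume "\<omega> \<in> ?B"
    then have sinks_K: "sinks K (contract_orientation \<omega>) = Some ` (sinks H \<omega> - {u1, u2}) \<union>
        (if u1 \<in> sinks H \<omega> \<and> u2 \<in> sinks H \<omega> then {None} else {})"
      by (intro sinks_contract) (simp_all add: acyclic_orientations_def)
    have "(\<Prod>v\<in>Some ` (sinks H \<omega> - {u1, u2}). contract_subst v) =
        (\<Prod>v\<in>sinks H \<omega> - {u1, u2}. Var v)"
      by (subst prod.reindex) (simp_all add: contract_subst_def)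
    then show "subst_poly contract_subst (\<Prod>v\<in>sinks K (contract_orientation \<omega>). Var v) = ?c \<omega>"
      unfolding sinks_K using finite_sinks[of \<omega>]
      by (subst subst_poly_prod_Var)
         (auto simp: prod.union_disjoint contract_subst_def mult.commute)
  qed
  \<comment> \<open>Padding with zeros gives all three polynomials the same index set.\<close>
  also have "\<dots> = (\<Sum>\<omega>\<in>acyclic_orientations H. if liftable \<omega> then ?c \<omega> else 0)"
    using finite_acyclic_orientations by (simp add: sum.inter_filter)
  finally show ?thesis .
qed

text \<open>Let \<open>ai\<close> be \<open>Var ui\<close> if \<open>ui\<close> is a sink and 1
  otherwise. Up to the factor of the other sinks, the liftable case reads
  \<open>a1 + a2 = a1 * a2 + c\<close>, that is, \<open>c = 1 - (1 - a1) * (1 - a2)\<close>. This is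
  the substituted value if both are sinks, and 1 as soon as some \<open>ai\<close> is 1.\<close>

lemma contributions_eq:
  assumes \<omega>: "\<omega> \<in> acyclic_orientations H"
  shows "(\<Sum>p\<in>{(u1, u2), (u2, u1)}.
        if acyclic (insert p (\<omega> ` E')) then \<Prod>v\<in>sinks G (\<omega>(e := p)). Var v else 0) =
      (\<Prod>v\<in>sinks H \<omega>. Var v) +
      (if liftable \<omega>
       then (\<Prod>v\<in>sinks H \<omega> - {u1, u2}. Var v) *
         (if u1 \<in> sinks H \<omega> \<and> u2 \<in> sinks H \<omega> then 1 - (1 - Var u1) * (1 - Var u2) else 1)
       else 0)"
proof -
  let ?r = "\<omega> ` E'" and ?S = "sinks H \<omega>"
  let ?P = "\<Prod>v\<in>?S - {u1, u2}. Var v"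
  have ac: "acyclic ?r" using \<omega> by (simp add: acyclic_orientations_def delete_simps)
  have path: "u1 \<notin> ?S" if "(u1, u2) \<in> ?r\<^sup>+" using not_sink_if_path[OF \<omega> that] .
  have path': "u2 \<notin> ?S" if "(u2, u1) \<in> ?r\<^sup>+" using not_sink_if_path[OF \<omega> that] .
  have not_both: "(u1, u2) \<notin> ?r\<^sup>+ \<or> (u2, u1) \<notin> ?r\<^sup>+"
    using ac unfolding acyclic_def by (meson trancl_trans)
  \<comment> \<open>\<open>acyclic_insert\<close> also counts the empty path, which
    \<open>neq\<close> excludes.\<close>
  have acyclic_1: "acyclic (insert (u1, u2) ?r) \<longleftrightarrow> (u2, u1) \<notin> ?r\<^sup>+"
    and acyclic_2: "acyclic (insert (u2, u1) ?r) \<longleftrightarrow> (u1, u2) \<notin> ?r\<^sup>+"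
    using ac neq by (auto simp: acyclic_insert rtrancl_eq_or_trancl)
  \<comment> \<open>The cases \<open>i = j\<close> of \<open>liftable\<close> are instances of
    acyclicity.\<close>
  have liftable: "liftable \<omega> \<longleftrightarrow> (u1, u2) \<notin> ?r\<^sup>+ \<and> (u2, u1) \<notin> ?r\<^sup>+"
    using ac unfolding liftable_def acyclic_def by auto
  have sinks: "sinks G (\<omega>(e := (u1, u2))) = ?S - {u1}" "sinks G (\<omega>(e := (u2, u1))) = ?S - {u2}"
    by (simp_all add: sinks_extend insert_commute)
  \<comment> \<open>Stated for general \<open>T\<close> to serve \<open>?S\<close>,
    \<open>?S - {u1}\<close> and \<open>?S - {u2}\<close> alike.\<close>
  have factor: "(\<Prod>v\<in>T. Var v) = ?P * (if u1 \<in> T then Var u1 else 1) * (if u2 \<in> T then Var u2 else 1)"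
    if "T \<subseteq> ?S" "?S - {u1, u2} \<subseteq> T" for T
  proof -
    have T: "T = (?S - {u1, u2}) \<union> (T \<inter> {u1, u2})" using that by auto
    have "(\<Prod>v\<in>T. Var v) = ?P * (\<Prod>v\<in>T \<inter> {u1, u2}. Var v)"
      by (subst T, rule prod.union_disjoint) (use finite_sinks[of \<omega>] in auto)
    then show ?thesis using neq by (auto simp: Int_insert_right)
  qed
  have S1: "(\<Prod>v\<in>?S - {u1}. Var v) = ?P * (if u2 \<in> ?S then Var u2 else 1)"
    and S2: "(\<Prod>v\<in>?S - {u2}. Var v) = ?P * (if u1 \<in> ?S then Var u1 else 1)"
    and S: "(\<Prod>v\<in>?S. Var v) =
      ?P * (if u1 \<in> ?S then Var u1 else 1) * (if u2 \<in> ?S then Var u2 else 1)"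
    using neq by (subst factor; auto)+
  have "(\<Sum>p\<in>{(u1, u2), (u2, u1)}.
        if acyclic (insert p ?r) then \<Prod>v\<in>sinks G (\<omega>(e := p)). Var v else 0) =
      (if (u2, u1) \<notin> ?r\<^sup>+ then \<Prod>v\<in>?S - {u1}. Var v else 0) +
      (if (u1, u2) \<notin> ?r\<^sup>+ then \<Prod>v\<in>?S - {u2}. Var v else 0)"
    using neq by (simp add: acyclic_1 acyclic_2 sinks del: acyclic_insert)
  then show ?thesis
    unfolding liftable S1 S2 S using path path' not_both
    by (cases "(u1, u2) \<in> ?r\<^sup>+"; cases "(u2, u1) \<in> ?r\<^sup>+"; cases "u1 \<in> ?S"; cases "u2 \<in> ?S")
       (simp_all add: algebra_simps)
qed

lemma deletion_contraction:
  "acyclic_orientation_poly G =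
     acyclic_orientation_poly H + subst_poly contract_subst (acyclic_orientation_poly K)"
  unfolding acyclic_orientation_poly_split subst_acyclic_orientation_poly_contract
    acyclic_orientation_poly_def[of H] sum.distrib[symmetric]
  by (rule sum.cong[OF refl contributions_eq])

end

theorem theorem2p3:
  fixes G :: "('v, 'e) multigraph" and e :: 'e and u1 u2 :: 'v
  assumes "finite_multigraph G"
    and "e \<in> edges G"
    and "ends G e = Upair u1 u2"
    and "u1 \<noteq> u2"
  shows "acyclic_orientation_poly G =
           acyclic_orientation_poly (delete_edge G e) +
           subst_poly (\<lambda>w. case w of None \<Rightarrow> 1 - (1 - Var u1) * (1 - Var u2) | Some v \<Rightarrow> Var v)
             (acyclic_orientation_poly (contract_edge G e))
         \<and> 1 - (1 - Var u1) * (1 - Var u2) = Var u1 + Var u2 - Var u1 * Var u2"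
proof -
  interpret multigraph_with_nonloop G e u1 u2
    using assms by unfold_locales
  have "contract_subst = (\<lambda>w. case w of None \<Rightarrow> 1 - (1 - Var u1) * (1 - Var u2) | Some v \<Rightarrow> Var v)"
    by (rule ext) (rule contract_subst_def)
  then show ?thesis
    using deletion_contraction by (simp add: algebra_simps)
qed

end
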